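(* Let $n\geq 2$ be an integer, let $X=l_1^{2^n-1}$, i.e. $\mathbb{R}^{2^n-1}$ with the norm $\|x\|=\sum_{i}|x_i|$, and let $B_X$ be its closed unit ball. Let $(\alpha_{i,j})_{0\leq i,j\leq 2^n-1}$ be the Walsh matrix $\mathbf{H}(2^n)$, let $a_i=(\alpha_{i,j})_{j=1}^{2^n-1}\in\mathbb{R}^{2^n-1}$ for $0\leq i\leq 2^n-1$ (the $i$-th row with its $0$-th entry deleted), and let $S$ be the simplex $\mathrm{conv}\{a_i: 0\leq i\leq 2^n-1\}$. For a vertex $v$ of $S$, let $F_v$ denote the facet of $S$ opposite to $v$. Then: \begin{enumerate} \item $\delta(S)=2^n$; \item for each vertex $v$ of $S$ and each point $w\in F_v$, $\|v-w\|=2^n$; moreover, the distance (in the norm $\|\cdot\|$) from $v$ to the affine hull $\mathrm{aff}\,F_v$ is $2^n$; \item $B_X\subseteq S$; \item $\Delta(S)=2$; \item $S$ is not reduced in $X$. \end{enumerate}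
   Context: Walsh matrices are defined recursively by $\mathbf{H}(2)=\begin{pmatrix}1&1\\1&-1\end{pmatrix}$ and $\mathbf{H}(2^{k})=\begin{pmatrix}\mathbf{H}(2^{k-1})&\mathbf{H}(2^{k-1})\\ \mathbf{H}(2^{k-1})&-\mathbf{H}(2^{k-1})\end{pmatrix}$ for $k\geq 2$; rows and columns of $\mathbf{H}(2^n)$ are indexed by $0,1,\dots,2^n-1$. The points $a_0,\dots,a_{2^n-1}$ are affinely independent, so $S$ is a $(2^n-1)$-dimensional simplex with these points as its vertices, and the facet $F_v$ opposite to a vertex $v$ is the convex hull of the other vertices. A convex body in $X$ is a compact convex set with nonempty interior. The width of a convex body $K$ in direction $u$ (a nonzero vector) is the distance, measured in the norm $\|\cdot\|$, between the two parallel supporting hyperplanes of $K$ that are orthogonal (in the Euclidean sense) to $u$. The thickness $\Delta(K)$ is the minimum of the width over all directions, and the diameter $\delta(K)$ is the maximum of the width over all directions (equivalently, $\delta(K)=\max\{\|x-y\|: x,y\in K\}$). A convex body $R$ is reduced in $X$ if $\Delta(C)<\Delta(R)$ for every convex body $C$ properly contained in $R$. *)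

theory Defs
  imports "HOL-Analysis.Analysis"
begin

section \<open>The space $l_1^d$\<close>

text \<open>The type \<^typ>\<open>real^'d\<close> carries the Euclidean norm in the library; the norm of the space
  considered here is \<open>l1_norm\<close>. In finite dimension both induce the same topology, so the library's
  \<^const>\<open>compact\<close> and \<^const>\<open>interior\<close> apply, and \<^const>\<open>inner\<close> provides Euclidean orthogonality.\<close>

definition l1_norm :: "real^'d::finite \<Rightarrow> real" where
  "l1_norm x = (\<Sum>i\<in>UNIV. \<bar>x $ i\<bar>)"

definition l1_unit_ball :: "(real^'d::finite) set" where
  "l1_unit_ball = {x. l1_norm x \<le> 1}"

definition l1_setdist :: "(real^'d::finite) set \<Rightarrow> (real^'d) set \<Rightarrow> real" where
  "l1_setdist A B = (INF (x, y) \<in> A \<times> B. l1_norm (x - y))"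


section \<open>Width, thickness, diameter, reducedness\<close>

definition convex_body :: "(real^'d::finite) set \<Rightarrow> bool" where
  "convex_body K \<longleftrightarrow> compact K \<and> convex K \<and> interior K \<noteq> {}"

text \<open>The two parallel hyperplanes orthogonal to \<open>u\<close> that support \<open>K\<close> are
  \<open>supporting_hyperplane K u\<close> and \<open>supporting_hyperplane K (- u)\<close>.\<close>

definition supporting_hyperplane :: "(real^'d::finite) set \<Rightarrow> real^'d \<Rightarrow> (real^'d) set" where
  "supporting_hyperplane K u = {x. u \<bullet> x = (SUP y\<in>K. u \<bullet> y)}"

definition l1_width :: "(real^'d::finite) set \<Rightarrow> real^'d \<Rightarrow> real" where
  "l1_width K u = l1_setdist (supporting_hyperplane K u) (supporting_hyperplane K (- u))"

text \<open>For compact nonempty \<open>K\<close> the infimum and the supremum below are attained; see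
  \<open>l1_thickness_minimum\<close> and \<open>l1_diameter_maximum\<close>.\<close>

definition l1_thickness :: "(real^'d::finite) set \<Rightarrow> real" where
  "l1_thickness K = (INF u\<in>-{0}. l1_width K u)"

definition l1_diameter :: "(real^'d::finite) set \<Rightarrow> real" where
  "l1_diameter K = (SUP u\<in>-{0}. l1_width K u)"

text \<open>That the set itself is a convex body is deliberately not a conjunct, so that
  \<open>\<not> l1_reduced R\<close> always yields a proper convex sub-body of no smaller thickness.\<close>

definition l1_reduced :: "(real^'d::finite) set \<Rightarrow> bool" where
  "l1_reduced R \<longleftrightarrow> (\<forall>C. convex_body C \<and> C \<subset> R \<longrightarrow> l1_thickness C < l1_thickness R)"


section \<open>Walsh matrices and the simplex\<close>

text \<open>\<open>walsh k i j\<close> is the entry of $H(2^k)$ in row \<open>i\<close> and column \<open>j\<close>; only \<open>i, j < 2 ^ k\<close> and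
  \<open>k \<ge> 1\<close> are meaningful.\<close>

fun walsh :: "nat \<Rightarrow> nat \<Rightarrow> nat \<Rightarrow> real" where
  "walsh 0 i j = 1"
| "walsh (Suc 0) i j = (if i = 1 \<and> j = 1 then - 1 else 1)"
| "walsh (Suc (Suc k)) i j =
    (let m = 2 ^ Suc k in
      if i < m then
        if j < m then walsh (Suc k) i j else walsh (Suc k) i (j - m)
      else
        if j < m then walsh (Suc k) (i - m) j else - walsh (Suc k) (i - m) (j - m))"

text \<open>The coordinate type \<open>'d\<close> is identified with the columns \<open>1, \<dots>, 2 ^ n - 1\<close> through a
  bijection \<open>col\<close>.\<close>

definition walsh_point :: "nat \<Rightarrow> ('d::finite \<Rightarrow> nat) \<Rightarrow> nat \<Rightarrow> real^'d" where
  "walsh_point n col i = (\<chi> j. walsh n i (col j))"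

definition walsh_vertices :: "nat \<Rightarrow> ('d::finite \<Rightarrow> nat) \<Rightarrow> (real^'d) set" where
  "walsh_vertices n col = walsh_point n col ` {0..2 ^ n - 1}"

definition walsh_simplex :: "nat \<Rightarrow> ('d::finite \<Rightarrow> nat) \<Rightarrow> (real^'d) set" where
  "walsh_simplex n col = convex hull (walsh_vertices n col)"

definition walsh_facet :: "nat \<Rightarrow> ('d::finite \<Rightarrow> nat) \<Rightarrow> real^'d \<Rightarrow> (real^'d) set" where
  "walsh_facet n col v = convex hull (walsh_vertices n col - {v})"


section \<open>Attainment of the extremal widths\<close>

lemma l1_inner_le: "\<bar>u \<bullet> x\<bar> \<le> infnorm u * l1_norm x" for u x :: "real^'d::finite"
proof -
  have "\<bar>u \<bullet> x\<bar> \<le> (\<Sum>i\<in>UNIV. \<bar>u $ i * x $ i\<bar>)"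
    unfolding inner_vec_def by simp
  also have "\<dots> \<le> (\<Sum>i\<in>UNIV. infnorm u * \<bar>x $ i\<bar>)"
    by (intro sum_mono) (simp add: abs_mult component_le_infnorm_cart mult_right_mono)
  finally show ?thesis by (simp add: l1_norm_def sum_distrib_left)
qed

lemma infnorm_attained:
  fixes u :: "real^'d::finite"
  obtains i where "infnorm u = \<bar>u $ i\<bar>"
proof -
  have *: "infnorm u = Max (range (\<lambda>i. \<bar>u $ i\<bar>))"
    unfolding infnorm_cart by (subst cSup_eq_Max[symmetric]) (simp_all add: full_SetCompr_eq)
  have "Max (range (\<lambda>i. \<bar>u $ i\<bar>)) \<in> range (\<lambda>i. \<bar>u $ i\<bar>)"
    by (intro Max_in) auto
  then obtain i where "Max (range (\<lambda>i. \<bar>u $ i\<bar>)) = \<bar>u $ i\<bar>" by (rule rangeE)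
  with * show ?thesis by (intro that) simp
qed

lemma l1_width_eq:
  fixes u :: "real^'d::finite"
  assumes K: "compact K" "K \<noteq> {}" and u: "u \<noteq> 0"
  shows "l1_width K u = ((SUP y\<in>K. u \<bullet> y) + (SUP y\<in>K. (- u) \<bullet> y)) / infnorm u"
proof -
  define M where "M = (SUP y\<in>K. u \<bullet> y)"
  define m where "m = (SUP y\<in>K. (- u) \<bullet> y)"
  have bdd: "bdd_above ((\<lambda>y. v \<bullet> y) ` K)" for v
    by (intro bounded_imp_bdd_above compact_imp_bounded compact_continuous_image
        continuous_intros K)
  obtain y0 where y0: "y0 \<in> K" using K by auto
  have "u \<bullet> y0 \<le> M" "(- u) \<bullet> y0 \<le> m"
    unfolding M_def m_def by (intro cSUP_upper y0 bdd)+
  then have nonneg: "0 \<le> M + m" by simp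
  obtain i where i: "infnorm u = \<bar>u $ i\<bar>" by (rule infnorm_attained)
  have pos: "infnorm u > 0" using u by (simp add: infnorm_pos_lt)
  define x where "x = (M / (u \<bullet> u)) *\<^sub>R u"
  define z where "z = axis i ((M + m) / u $ i)"
  have ux: "u \<bullet> x = M" using u by (simp add: x_def)
  have uz: "u \<bullet> z = M + m" using i pos by (auto simp: z_def inner_axis)
  have lz: "l1_norm z = (M + m) / infnorm u"
  proof -
    have "l1_norm z = (\<Sum>j\<in>UNIV. if j = i then \<bar>(M + m) / u $ i\<bar> else 0)"
      unfolding l1_norm_def z_def axis_def by (intro sum.cong) auto
    then show ?thesis using nonneg i by simp
  qed
  have "(INF (x, y) \<in> supporting_hyperplane K u \<times> supporting_hyperplane K (- u). l1_norm (x - y))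
      = (M + m) / infnorm u"
  proof (rule cInf_eq_minimum)
    show "(M + m) / infnorm u \<in> (\<lambda>(x, y). l1_norm (x - y)) `
        (supporting_hyperplane K u \<times> supporting_hyperplane K (- u))"
    proof (rule image_eqI)
      show "(M + m) / infnorm u = (case (x, x - z) of (x, y) \<Rightarrow> l1_norm (x - y))"
        by (simp add: lz)
      have "x \<in> supporting_hyperplane K u"
        unfolding supporting_hyperplane_def M_def[symmetric] using ux by simp
      moreover have "x - z \<in> supporting_hyperplane K (- u)"
        unfolding supporting_hyperplane_def m_def[symmetric] using ux uz
        by (simp add: inner_diff_right)
      ultimately show "(x, x - z) \<in> supporting_hyperplane K u \<times> supporting_hyperplane K (- u)"
        by simp
    qed
  next
    fix t
    assume "t \<in> (\<lambda>(x, y). l1_norm (x - y)) `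
        (supporting_hyperplane K u \<times> supporting_hyperplane K (- u))"
    then obtain p q where t: "t = l1_norm (p - q)" and p: "u \<bullet> p = M" and q: "(- u) \<bullet> q = m"
      unfolding supporting_hyperplane_def M_def m_def by auto
    have "M + m = u \<bullet> (p - q)" using p q by (simp add: inner_diff_right)
    also have "\<dots> \<le> infnorm u * t" unfolding t using l1_inner_le[of u "p - q"] by linarith
    finally show "(M + m) / infnorm u \<le> t" using pos by (simp add: divide_le_eq mult.commute)
  qed
  then show ?thesis by (simp add: l1_width_def l1_setdist_def M_def m_def)
qed

lemma continuous_on_support:
  fixes K :: "(real^'d::finite) set"
  assumes K: "compact K" "K \<noteq> {}"
  shows "continuous_on A (\<lambda>u. SUP y\<in>K. u \<bullet> y)"
proof -
  have bdd: "bdd_above ((\<lambda>y. v \<bullet> y) ` K)" for v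
    by (intro bounded_imp_bdd_above compact_imp_bounded compact_continuous_image
        continuous_intros K)
  obtain B where B: "\<And>y. y \<in> K \<Longrightarrow> norm y \<le> B" and B0: "B > 0"
    using compact_imp_bounded[OF K(1)] by (auto simp: bounded_pos)
  have le: "(SUP y\<in>K. u \<bullet> y) \<le> (SUP y\<in>K. v \<bullet> y) + B * norm (u - v)" for u v
  proof (rule cSUP_least[OF K(2)])
    fix y assume y: "y \<in> K"
    have "u \<bullet> y = v \<bullet> y + (u - v) \<bullet> y" by (simp add: inner_diff_left)
    moreover have "v \<bullet> y \<le> (SUP y\<in>K. v \<bullet> y)" by (intro cSUP_upper y bdd)
    moreover have "(u - v) \<bullet> y \<le> norm (u - v) * norm y" by (rule norm_cauchy_schwarz)
    moreover have "\<dots> \<le> B * norm (u - v)"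
      using B[OF y] by (simp add: mult.commute mult_right_mono)
    ultimately show "u \<bullet> y \<le> (SUP y\<in>K. v \<bullet> y) + B * norm (u - v)" by linarith
  qed
  have "B-lipschitz_on A (\<lambda>u. SUP y\<in>K. u \<bullet> y)"
  proof (rule lipschitz_onI)
    fix u v
    show "dist (SUP y\<in>K. u \<bullet> y) (SUP y\<in>K. v \<bullet> y) \<le> B * dist u v"
      using le[of u v] le[of v u] by (simp add: dist_norm norm_minus_commute abs_le_iff)
  qed (use B0 in simp)
  then show ?thesis by (rule lipschitz_on_continuous_on)
qed

lemma l1_width_sgn:
  fixes u :: "real^'d::finite"
  assumes K: "compact K" "K \<noteq> {}" and u: "u \<noteq> 0"
  shows "l1_width K (sgn u) = l1_width K u"
proof -
  define c where "c = inverse (norm u)"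
  have c: "c > 0" "sgn u = c *\<^sub>R u" using u by (auto simp: c_def sgn_div_norm)
  have hyp: "supporting_hyperplane K (c *\<^sub>R v) = supporting_hyperplane K v" for v
  proof -
    have "(SUP y\<in>K. c * (v \<bullet> y)) = c * (SUP y\<in>K. v \<bullet> y)"
    proof -
      have "compact ((\<lambda>y. v \<bullet> y) ` K)"
        by (intro compact_continuous_image continuous_intros K)
      then have "bdd_above ((\<lambda>y. v \<bullet> y) ` K)"
        by (intro bounded_imp_bdd_above compact_imp_bounded)
      then have "c * Sup ((\<lambda>y. v \<bullet> y) ` K) = (SUP t\<in>(\<lambda>y. v \<bullet> y) ` K. c * t)"
        using K c by (intro continuous_at_Sup_mono monoI continuous_intros) auto
      then show ?thesis by (simp add: image_image)
    qed
    then show ?thesis using c by (simp add: supporting_hyperplane_def)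
  qed
  have "- (c *\<^sub>R u) = c *\<^sub>R (- u)" by simp
  then show ?thesis unfolding l1_width_def c(2) by (simp only: hyp)
qed

lemma continuous_on_l1_width:
  fixes K :: "(real^'d::finite) set"
  assumes K: "compact K" "K \<noteq> {}"
  shows "continuous_on (sphere 0 1) (l1_width K)"
proof -
  have "continuous_on (sphere 0 1) (\<lambda>u. SUP y\<in>K. u \<bullet> y)"
    by (rule continuous_on_support[OF K])
  moreover have "continuous_on (sphere 0 1) (\<lambda>u. SUP y\<in>K. (- u) \<bullet> y)"
    by (rule continuous_on_compose2[OF continuous_on_support[OF K, of UNIV]])
      (auto intro: continuous_intros)
  moreover have "continuous_on (sphere 0 1) (infnorm :: real^'d \<Rightarrow> real)"
    by (simp add: continuous_on_eq_continuous_within continuous_infnorm)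
  ultimately have "continuous_on (sphere 0 1)
      (\<lambda>u. ((SUP y\<in>K. u \<bullet> y) + (SUP y\<in>K. (- u) \<bullet> y)) / infnorm u)"
    by (intro continuous_on_divide continuous_on_add) (auto simp: infnorm_eq_0)
  then show ?thesis
    by (rule continuous_on_eq) (rule l1_width_eq[OF K, symmetric], auto)
qed

lemma sphere_nonempty: "sphere (0 :: real^'d::finite) 1 \<noteq> {}"
proof -
  have "(axis undefined 1 :: real^'d) \<in> sphere 0 1" by (simp add: norm_axis_1)
  then show ?thesis by blast
qed

lemma l1_thickness_minimum:
  fixes K :: "(real^'d::finite) set"
  assumes K: "compact K" "K \<noteq> {}"
  shows "\<exists>u. u \<noteq> 0 \<and> l1_width K u = l1_thickness K"
    and "u \<noteq> 0 \<Longrightarrow> l1_thickness K \<le> l1_width K u"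
proof -
  obtain w where w: "w \<in> sphere 0 1" and *: "\<And>v. v \<in> sphere 0 1 \<Longrightarrow> l1_width K w \<le> l1_width K v"
    using continuous_attains_inf[OF compact_sphere sphere_nonempty continuous_on_l1_width[OF K]]
    by blast
  have w0: "w \<noteq> 0" using w by auto
  have le: "l1_width K w \<le> l1_width K v" if "v \<noteq> 0" for v
    using *[of "sgn v"] that l1_width_sgn[OF K that] by (simp add: norm_sgn)
  have eq: "l1_thickness K = l1_width K w"
    unfolding l1_thickness_def by (rule cInf_eq_minimum) (use w0 le in auto)
  show "\<exists>u. u \<noteq> 0 \<and> l1_width K u = l1_thickness K" using eq w0 by auto
  show "u \<noteq> 0 \<Longrightarrow> l1_thickness K \<le> l1_width K u" using eq le by simp
qed

lemma l1_diameter_maximum: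
  fixes K :: "(real^'d::finite) set"
  assumes K: "compact K" "K \<noteq> {}"
  shows "\<exists>u. u \<noteq> 0 \<and> l1_width K u = l1_diameter K"
    and "u \<noteq> 0 \<Longrightarrow> l1_width K u \<le> l1_diameter K"
proof -
  obtain w where w: "w \<in> sphere 0 1" and *: "\<And>v. v \<in> sphere 0 1 \<Longrightarrow> l1_width K v \<le> l1_width K w"
    using continuous_attains_sup[OF compact_sphere sphere_nonempty continuous_on_l1_width[OF K]]
    by blast
  have w0: "w \<noteq> 0" using w by auto
  have le: "l1_width K v \<le> l1_width K w" if "v \<noteq> 0" for v
    using *[of "sgn v"] that l1_width_sgn[OF K that] by (simp add: norm_sgn)
  have eq: "l1_diameter K = l1_width K w"
    unfolding l1_diameter_def by (rule cSup_eq_maximum) (use w0 le in auto)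
  show "\<exists>u. u \<noteq> 0 \<and> l1_width K u = l1_diameter K" using eq w0 by auto
  show "u \<noteq> 0 \<Longrightarrow> l1_width K u \<le> l1_diameter K" using eq le by simp
qed

end

theory Submission
  imports Defs
begin

text \<open>Put \<open>N = 2 ^ n\<close>. Orthogonality of the rows of the Walsh matrix gives \<open>a\<^sub>i \<bullet> a\<^sub>k = -1\<close> for
  \<open>i \<noteq> k\<close> and \<open>a\<^sub>i \<bullet> a\<^sub>i = N - 1\<close>. Since the entries are \<open>\<plusminus>1\<close>, vertices have mutual distance
  \<open>N\<close>, and the functional \<open>a\<^sub>v\<close>, of dual norm \<open>1\<close>, separates \<open>a\<^sub>v\<close> from the opposite facet by
  \<open>N\<close>. Orthogonality of the columns shows that the numbers \<open>(1 + a\<^sub>i \<bullet> x) / N\<close> are barycentric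
  coordinates of \<open>x\<close>; they are nonnegative on the unit ball. Hence the simplex contains the
  ball, which already has thickness \<open>2\<close>, while each coordinate functional has width \<open>2\<close> on the
  simplex. The ball itself is the proper sub-body violating reducedness.\<close>

section \<open>Walsh matrices\<close>

text \<open>Merges the two recursive clauses of \<open>walsh\<close> into one block rule that
  already holds at \<open>k = 0\<close>, so that later inductions can start from the 1 x 1 matrix.
  Only the lower right block changes sign.\<close>

lemma walsh_Suc:
  assumes "i < 2 ^ Suc k" "j < 2 ^ Suc k"
  shows "walsh (Suc k) i j =
    (if 2 ^ k \<le> i \<and> 2 ^ k \<le> j then - 1 else 1) * walsh k (i mod 2 ^ k) (j mod 2 ^ k)"
proof (cases k)
  case 0
  then show ?thesis using assms by auto
next
  case (Suc l)
  have mod: "a mod 2 ^ k = (if a < 2 ^ k then a else a - 2 ^ k)" if "a < 2 ^ Suc k" for a :: nat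
    using that by (auto simp: mod_if)
  show ?thesis
    unfolding mod[OF assms(1)] mod[OF assms(2)] unfolding Suc
    by (simp add: Let_def linorder_not_le[symmetric] del: power_Suc)
qed

lemma walsh_abs: "i < 2 ^ k \<Longrightarrow> j < 2 ^ k \<Longrightarrow> \<bar>walsh k i j\<bar> = 1"
proof (induction k arbitrary: i j)
  case (Suc k)
  then show ?case
    by (simp only: walsh_Suc abs_mult Suc.IH mod_less_divisor zero_less_power) simp
qed simp

lemma walsh_commute: "i < 2 ^ k \<Longrightarrow> j < 2 ^ k \<Longrightarrow> walsh k i j = walsh k j i"
proof (induction k arbitrary: i j)
  case (Suc k)
  then show ?case
    using Suc.IH[of "i mod 2 ^ k" "j mod 2 ^ k"]
    by (simp only: walsh_Suc) (simp add: conj_commute)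
qed simp

lemma walsh_zero_right: "i < 2 ^ k \<Longrightarrow> walsh k i 0 = 1"
proof (induction k arbitrary: i)
  case (Suc k)
  then show ?case using walsh_Suc[of i k 0] Suc.IH[of "i mod 2 ^ k"] by simp
qed simp

text \<open>The right half of a row repeats its left half up to a sign \<open>s\<close>, so the
  product of two rows sums to \<open>1 + s i * s l\<close> times a product of shorter rows. The
  factor is 2 if both rows lie in the same half of the matrix and 0 otherwise.\<close>

lemma walsh_rows_orthogonal:
  assumes "i < 2 ^ k" "l < 2 ^ k"
  shows "(\<Sum>j<2 ^ k. walsh k i j * walsh k l j) = (if i = l then 2 ^ k else 0)"
  using assms
proof (induction k arbitrary: i l)
  case 0
  then show ?case by simp
next
  case (Suc k)
  define m :: nat where "m = 2 ^ k"
  define s where "s a = (if m \<le> a then - 1 else 1 :: real)" for a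
  define f where "f j = walsh (Suc k) i j * walsh (Suc k) l j" for j
  define g where "g j = walsh k (i mod m) j * walsh k (l mod m) j" for j
  have m: "2 ^ Suc k = m + m" "m > 0" by (simp_all add: m_def)
  have low: "f j = g j" if "j < m" for j
    using that Suc.prems m
    by (simp add: f_def g_def walsh_Suc m_def del: walsh.simps(2,3) power_Suc)
  have high: "f (m + j) = s i * s l * g j" if "j < m" for j
    using that Suc.prems m
    by (simp add: f_def g_def s_def walsh_Suc m_def del: walsh.simps(2,3) power_Suc)
  have "(\<Sum>j<2 ^ Suc k. f j) = (\<Sum>j<m. f j) + (\<Sum>j<m. f (m + j))"
    unfolding m using sum.atLeastLessThan_concat[of 0 m "m + m" f]
      sum.shift_bounds_nat_ivl[of f 0 m m]
    by (simp add: atLeast0LessThan add.commute)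
  also have "\<dots> = (1 + s i * s l) * (\<Sum>j<m. g j)"
    by (simp add: low high distrib_right flip: sum_distrib_left)
  also have "(\<Sum>j<m. g j) = (if i mod m = l mod m then m else 0)"
    using Suc.IH[of "i mod m" "l mod m"] by (simp add: g_def m_def)
  \<comment> \<open>Distinct rows with equal residues mod \<open>m\<close> lie in different halves,
    where the signs cancel.\<close>
  also have "(1 + s i * s l) * (if i mod m = l mod m then m else 0) = (if i = l then 2 ^ Suc k else 0)"
    using Suc.prems m by (auto simp: s_def m_def mod_if split: if_splits)
  finally show ?case by (simp add: f_def)
qed

lemma walsh_columns_orthogonal:
  assumes "i < 2 ^ k" "l < 2 ^ k"
  shows "(\<Sum>j<2 ^ k. walsh k j i * walsh k j l) = (if i = l then 2 ^ k else 0)"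
proof -
  have "(\<Sum>j<2 ^ k. walsh k j i * walsh k j l) = (\<Sum>j<2 ^ k. walsh k i j * walsh k l j)"
    by (rule sum.cong[OF refl]) (metis walsh_commute assms lessThan_iff)
  then show ?thesis using walsh_rows_orthogonal[OF assms] by simp
qed


section \<open>The $l_1$ norm and width\<close>

lemma l1_norm_triangle: "l1_norm (x + y) \<le> l1_norm x + l1_norm y"
  by (simp add: l1_norm_def sum.distrib[symmetric] sum_mono)

lemma l1_norm_scaleR: "l1_norm (c *\<^sub>R x) = \<bar>c\<bar> * l1_norm x"
  by (simp add: l1_norm_def abs_mult sum_distrib_left)

lemma l1_norm_axis: "l1_norm (axis i c) = \<bar>c\<bar>"
proof -
  have "l1_norm (axis i c) = (\<Sum>j\<in>UNIV. if j = i then \<bar>c\<bar> else 0)"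
    unfolding l1_norm_def axis_def by (intro sum.cong) auto
  then show ?thesis by simp
qed

lemma continuous_on_l1_norm: "continuous_on A l1_norm"
  unfolding l1_norm_def by (intro continuous_intros)

lemma convex_l1_cball: "convex {x. l1_norm (x - y) \<le> c}"
proof (rule convexI, clarify)
  fix a b and s t :: real
  assume a: "l1_norm (a - y) \<le> c" and b: "l1_norm (b - y) \<le> c"
    and st: "0 \<le> s" "0 \<le> t" "s + t = 1"
  have "s *\<^sub>R y + t *\<^sub>R y = y" using st by (simp flip: scaleR_add_left)
  then have "s *\<^sub>R a + t *\<^sub>R b - y = s *\<^sub>R (a - y) + t *\<^sub>R (b - y)"
    by (simp add: scaleR_diff_right algebra_simps)
  then have "l1_norm (s *\<^sub>R a + t *\<^sub>R b - y) \<le> s * l1_norm (a - y) + t * l1_norm (b - y)"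
    using l1_norm_triangle[of "s *\<^sub>R (a - y)" "t *\<^sub>R (b - y)"] st by (simp add: l1_norm_scaleR)
  also have "\<dots> \<le> c" using a b st by (intro convex_bound_le)
  finally show "l1_norm (s *\<^sub>R a + t *\<^sub>R b - y) \<le> c" .
qed

text \<open>Balls are convex, so a bound on distances between generators passes to the hulls, one
  argument at a time.\<close>

lemma l1_norm_diff_hull_le:
  assumes "\<And>v w. v \<in> A \<Longrightarrow> w \<in> B \<Longrightarrow> l1_norm (v - w) \<le> c"
    and "x \<in> convex hull A" "y \<in> convex hull B"
  shows "l1_norm (x - y) \<le> c"
proof -
  have minus: "l1_norm (a - b) = l1_norm (b - a)" for a b
    by (simp add: l1_norm_def abs_minus_commute)
  have *: "l1_norm (x - w) \<le> c" if "w \<in> B" for w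
    using hull_minimal[of A "{x. l1_norm (x - w) \<le> c}" convex] assms that
    by (auto simp: convex_l1_cball)
  have "B \<subseteq> {y. l1_norm (y - x) \<le> c}" using * by (auto simp: minus)
  then have "convex hull B \<subseteq> {y. l1_norm (y - x) \<le> c}" by (intro hull_minimal convex_l1_cball)
  then show ?thesis using assms(3) minus[of x y] by auto
qed

lemma convex_body_l1_unit_ball: "convex_body l1_unit_ball"
  unfolding convex_body_def
proof (intro conjI)
  have "closed (l1_norm -` {..1})"
    by (intro closed_vimage continuous_on_l1_norm) simp
  moreover have "bounded l1_unit_ball"
    unfolding bounded_iff l1_unit_ball_def
    by (intro exI[of _ 1]) (auto simp: l1_norm_def intro: order_trans[OF norm_le_l1_cart])
  ultimately show "compact l1_unit_ball"
    by (simp add: compact_eq_bounded_closed l1_unit_ball_def vimage_def)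
  show "convex l1_unit_ball" using convex_l1_cball[of 0 1] by (simp add: l1_unit_ball_def)
  have "open (l1_norm -` {..<1})"
    by (intro open_vimage continuous_on_l1_norm) simp
  then have "l1_norm -` {..<1} \<subseteq> interior l1_unit_ball"
    by (intro interior_maximal) (auto simp: l1_unit_ball_def)
  moreover have "0 \<in> l1_norm -` {..<1}" by (simp add: l1_norm_def)
  ultimately show "interior l1_unit_ball \<noteq> {}" by blast
qed

text \<open>The width is the oscillation of \<open>u\<close> on \<open>K\<close> divided by the dual
  norm \<open>infnorm u\<close>. This lemma and \<open>l1_width_le\<close> reduce width bounds to
  inequalities between pairs of points.\<close>

lemma l1_width_ge:
  assumes K: "compact K" and xy: "x \<in> K" "y \<in> K" and u: "u \<noteq> 0"
  shows "(u \<bullet> x - u \<bullet> y) / infnorm u \<le> l1_width K u"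
proof -
  have bdd: "bdd_above ((\<lambda>y. v \<bullet> y) ` K)" for v
    by (intro bounded_imp_bdd_above compact_imp_bounded compact_continuous_image
        continuous_intros K)
  have "u \<bullet> x \<le> (SUP y\<in>K. u \<bullet> y)" "(- u) \<bullet> y \<le> (SUP y\<in>K. (- u) \<bullet> y)"
    by (intro cSUP_upper bdd xy)+
  moreover have "K \<noteq> {}" using xy by auto
  ultimately show ?thesis
    using l1_width_eq[OF K _ u] by (simp add: divide_right_mono infnorm_pos_le)
qed

lemma l1_width_le:
  assumes K: "compact K" "K \<noteq> {}" and u: "u \<noteq> 0"
    and le: "\<And>x y. x \<in> K \<Longrightarrow> y \<in> K \<Longrightarrow> u \<bullet> x - u \<bullet> y \<le> c * infnorm u"
  shows "l1_width K u \<le> c"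
proof -
  \<comment> \<open>The suprema are bounded in two stages: over \<open>x\<close> for fixed
    \<open>y\<close>, then over \<open>y\<close>.\<close>
  have "(SUP y\<in>K. (- u) \<bullet> y) \<le> c * infnorm u - (SUP x\<in>K. u \<bullet> x)"
  proof (rule cSUP_least[OF K(2)])
    fix y assume y: "y \<in> K"
    have "(SUP x\<in>K. u \<bullet> x) \<le> c * infnorm u + u \<bullet> y"
      by (rule cSUP_least[OF K(2)]) (use le[OF _ y] in force)
    then show "(- u) \<bullet> y \<le> c * infnorm u - (SUP x\<in>K. u \<bullet> x)" by simp
  qed
  then show ?thesis
    using l1_width_eq[OF K u] u by (simp add: divide_le_eq infnorm_pos_lt)
qed

text \<open>For every direction the ball contains two opposite points that realise the dual norm:
  plus and minus the signed unit vector at a coordinate where \<open>u\<close> is largest in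
  absolute value. The lemma serves both the simplex and the ball itself.\<close>

lemma l1_thickness_ge_2:
  assumes K: "compact K" and sub: "l1_unit_ball \<subseteq> K"
  shows "2 \<le> l1_thickness K"
proof -
  have "0 \<in> l1_unit_ball" by (simp add: l1_unit_ball_def l1_norm_def)
  then have ne: "K \<noteq> {}" using sub by auto
  obtain u where u: "u \<noteq> 0" "l1_width K u = l1_thickness K"
    using l1_thickness_minimum(1)[OF K ne] by blast
  obtain i where i: "infnorm u = \<bar>u $ i\<bar>" by (rule infnorm_attained)
  have pos: "infnorm u > 0" using u by (simp add: infnorm_pos_lt)
  define z where "z = axis i (sgn (u $ i))"
  have "z \<in> l1_unit_ball" "- z \<in> l1_unit_ball"
    using l1_norm_scaleR[of "- 1" z]
    by (simp_all add: z_def l1_unit_ball_def l1_norm_axis abs_sgn_eq)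
  then have "(u \<bullet> z - u \<bullet> (- z)) / infnorm u \<le> l1_width K u"
    using sub by (intro l1_width_ge K u) auto
  moreover have "u \<bullet> z = infnorm u" by (simp add: z_def inner_axis i abs_sgn)
  ultimately show ?thesis using pos u by simp
qed


section \<open>The Walsh simplex\<close>

context
  fixes n :: nat and col :: "'d::finite \<Rightarrow> nat"
  assumes col: "bij_betw col UNIV {1..2 ^ n - 1}"
begin

section \<open>Coordinates and inner products of the vertices\<close>

lemma col_less: "col j < 2 ^ n" and col_pos: "0 < col j"
proof -
  have "col j \<in> {1..2 ^ n - 1}" using col by (auto simp: bij_betw_def)
  moreover have "(0::nat) < 2 ^ n" by simp
  ultimately show "col j < 2 ^ n" "0 < col j" by (simp_all only: atLeastAtMost_iff; linarith)+
qed

lemma walsh_vertices_eq: "walsh_vertices n col = walsh_point n col ` {..<2 ^ n}"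
proof -
  have "{0..2 ^ n - 1} = {..<2 ^ n :: nat}"
    by (simp add: atLeast0AtMost flip: lessThan_Suc_atMost)
  then show ?thesis by (simp add: walsh_vertices_def)
qed

text \<open>Coordinates omit column 0, whose entries are all 1; the subtracted term is the source of
  the -1 in \<open>inner_walsh_point\<close>.\<close>

lemma sum_col: "(\<Sum>j\<in>UNIV. f (col j)) = (\<Sum>j<2 ^ n. f j) - (f 0 :: real)"
proof -
  have "(\<Sum>j\<in>UNIV. f (col j)) = sum f {1..2 ^ n - 1}"
    by (rule sum.reindex_bij_betw[OF col])
  also have "{1..2 ^ n - 1} = {..<2 ^ n} - {0 :: nat}"
    by (auto simp: le_diff_conv2)
  finally show ?thesis by (simp add: sum_diff1)
qed

lemma walsh_point_abs: "i < 2 ^ n \<Longrightarrow> \<bar>walsh_point n col i $ j\<bar> = 1"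
  by (simp add: walsh_point_def walsh_abs col_less)

lemma inner_walsh_point:
  assumes "i < 2 ^ n" "k < 2 ^ n"
  shows "walsh_point n col i \<bullet> walsh_point n col k = (if i = k then 2 ^ n else 0) - 1"
  using sum_col[of "\<lambda>j. walsh n i j * walsh n k j"] walsh_rows_orthogonal[OF assms] assms
  by (simp add: inner_vec_def walsh_point_def walsh_zero_right)

lemma infnorm_walsh_point:
  assumes "i < 2 ^ n"
  shows "infnorm (walsh_point n col i) = 1"
  using infnorm_attained[of "walsh_point n col i"] walsh_point_abs[OF assms] by metis

lemma walsh_point_nonzero: "i < 2 ^ n \<Longrightarrow> walsh_point n col i \<noteq> 0"
  using infnorm_walsh_point[of i] by (auto simp: infnorm_0)

lemma l1_norm_walsh_point_diff:
  assumes "i < 2 ^ n" "k < 2 ^ n"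
  shows "l1_norm (walsh_point n col i - walsh_point n col k) = (if i = k then 0 else 2 ^ n)"
proof -
  \<comment> \<open>For \<open>a, b = \<plusminus>1\<close> one has \<open>\<bar>a - b\<bar> = a\<^sup>2 - a b\<close>.\<close>
  have "\<bar>walsh_point n col i $ j - walsh_point n col k $ j\<bar> =
      walsh_point n col i $ j * walsh_point n col i $ j -
      walsh_point n col i $ j * walsh_point n col k $ j" for j
    using walsh_point_abs[OF assms(1), of j] walsh_point_abs[OF assms(2), of j]
    by (auto simp: abs_if split: if_splits)
  then have "l1_norm (walsh_point n col i - walsh_point n col k) =
      walsh_point n col i \<bullet> walsh_point n col i - walsh_point n col i \<bullet> walsh_point n col k"
    by (simp add: l1_norm_def inner_vec_def sum_subtractf)
  then show ?thesis using assms by (simp add: inner_walsh_point)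
qed

lemma compact_walsh_simplex: "compact (walsh_simplex n col)"
  by (simp add: walsh_simplex_def walsh_vertices_def compact_convex_hull finite_imp_compact)

lemma walsh_point_in_simplex: "i < 2 ^ n \<Longrightarrow> walsh_point n col i \<in> walsh_simplex n col"
  unfolding walsh_simplex_def walsh_vertices_eq by (intro hull_inc) auto

lemma walsh_simplex_nonempty: "walsh_simplex n col \<noteq> {}"
  using walsh_point_in_simplex[of 0] by auto

section \<open>The unit ball inside the simplex\<close>

lemma l1_unit_ball_subset_walsh_simplex: "l1_unit_ball \<subseteq> walsh_simplex n col"
proof
  fix x :: "real^'d" assume x: "x \<in> l1_unit_ball"
  define c where "c i = (1 + walsh_point n col i \<bullet> x) / 2 ^ n" for i
  \<comment> \<open>Orthogonality of column \<open>col k\<close> to the all-ones column 0, which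
    differs from it by \<open>col_pos\<close>.\<close>
  have column: "(\<Sum>i<2 ^ n. walsh_point n col i $ k) = 0" for k
    using walsh_columns_orthogonal[of 0 n "col k"] col_less[of k] col_pos[of k]
    by (simp add: walsh_point_def walsh_zero_right)
  have dual: "(\<Sum>i<2 ^ n. walsh_point n col i \<bullet> x) = 0"
    by (simp add: inner_vec_def) (subst sum.swap, simp add: column flip: sum_distrib_right)
  \<comment> \<open>Each vertex has dual norm 1, so its inner product with a point of the ball is at
    least -1.\<close>
  have "c i \<ge> 0" if "i < 2 ^ n" for i
    using l1_inner_le[of "walsh_point n col i" x] x that
    by (simp add: infnorm_walsh_point l1_unit_ball_def c_def)
  moreover have "(\<Sum>i<2 ^ n. c i) = 1"
    by (simp add: c_def dual sum.distrib flip: sum_divide_distrib)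
  ultimately have "(\<Sum>i<2 ^ n. c i *\<^sub>R walsh_point n col i) \<in> walsh_simplex n col"
    by (intro convex_sum walsh_point_in_simplex) (auto simp: walsh_simplex_def)
  also have "(\<Sum>i<2 ^ n. c i *\<^sub>R walsh_point n col i) = x"
  proof (rule vec_eq_iff[THEN iffD2, rule_format])
    fix k
    have columns: "(\<Sum>i<2 ^ n. walsh_point n col i $ j * walsh_point n col i $ k) =
        (if j = k then 2 ^ n else 0)" for j
      using walsh_columns_orthogonal[OF col_less col_less, of j k] col
      by (auto simp: walsh_point_def bij_betw_def inj_eq)
    \<comment> \<open>Expanding the inner product leaves only the term \<open>j = k\<close>; the
      constant part of \<open>c i\<close> vanishes by \<open>column\<close>.\<close>
    have "(\<Sum>i<2 ^ n. (walsh_point n col i \<bullet> x) * walsh_point n col i $ k) =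
        (\<Sum>j\<in>UNIV. \<Sum>i<2 ^ n. x $ j * (walsh_point n col i $ j * walsh_point n col i $ k))"
      by (subst sum.swap) (simp add: inner_vec_def sum_distrib_left mult_ac)
    also have "\<dots> = 2 ^ n * x $ k"
      by (simp add: columns if_distrib cong: if_cong flip: sum_distrib_left)
    finally show "(\<Sum>i<2 ^ n. c i *\<^sub>R walsh_point n col i) $ k = x $ k"
      by (simp add: c_def column sum.distrib ring_distribs add_divide_distrib
          flip: sum_divide_distrib)
  qed
  finally show "x \<in> walsh_simplex n col" .
qed

section \<open>Diameter\<close>

lemma l1_diameter_walsh_simplex: "l1_diameter (walsh_simplex n col) = 2 ^ n" if "n \<ge> 1"
proof (rule antisym)
  let ?S = "walsh_simplex n col"
  note K = compact_walsh_simplex walsh_simplex_nonempty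
  have dist: "l1_norm (x - y) \<le> 2 ^ n" if "x \<in> ?S" "y \<in> ?S" for x y
    using that unfolding walsh_simplex_def
    by (rule l1_norm_diff_hull_le[rotated]) (auto simp: walsh_vertices_eq l1_norm_walsh_point_diff)
  obtain u where u: "u \<noteq> 0" "l1_width ?S u = l1_diameter ?S"
    using l1_diameter_maximum(1)[OF K] by blast
  have "l1_width ?S u \<le> 2 ^ n"
  proof (rule l1_width_le[OF K u(1)])
    fix x y assume "x \<in> ?S" "y \<in> ?S"
    then have "infnorm u * l1_norm (x - y) \<le> infnorm u * 2 ^ n"
      by (intro mult_left_mono dist infnorm_pos_le)
    then show "u \<bullet> x - u \<bullet> y \<le> 2 ^ n * infnorm u"
      using l1_inner_le[of u "x - y"] by (simp add: inner_diff_right mult.commute)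
  qed
  then show "l1_diameter ?S \<le> 2 ^ n" using u by simp
  let ?a = "walsh_point n col"
  have i: "0 < (2::nat) ^ n" "1 < (2::nat) ^ n"
    using that by (simp, intro one_less_power) auto
  \<comment> \<open>As a direction, a vertex separates itself from any other vertex by
    \<open>(2 ^ n - 1) - (- 1)\<close>, and its dual norm is 1.\<close>
  have "(?a 0 \<bullet> ?a 0 - ?a 0 \<bullet> ?a 1) / infnorm (?a 0) \<le> l1_width ?S (?a 0)"
    by (intro l1_width_ge K walsh_point_in_simplex walsh_point_nonzero i)
  also have "\<dots> \<le> l1_diameter ?S"
    by (intro l1_diameter_maximum(2) K walsh_point_nonzero i)
  finally show "2 ^ n \<le> l1_diameter ?S"
    using i by (simp add: inner_walsh_point infnorm_walsh_point)
qed

section \<open>Distance from a vertex to the opposite facet\<close>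

lemma l1_norm_vertex_affine_facet_ge:
  assumes v: "v \<in> walsh_vertices n col" and w: "w \<in> affine hull (walsh_facet n col v)"
  shows "2 ^ n \<le> l1_norm (v - w)"
proof -
  obtain i where i: "v = walsh_point n col i" "i < 2 ^ n"
    using v by (auto simp: walsh_vertices_eq)
  \<comment> \<open>All other vertices lie on one hyperplane orthogonal to \<open>v\<close>, which
    therefore also contains the affine hull of the facet.\<close>
  have "walsh_facet n col v \<subseteq> {w. v \<bullet> w = - 1}"
    unfolding walsh_facet_def
    by (rule hull_minimal) (auto simp: i walsh_vertices_eq inner_walsh_point convex_hyperplane)
  then have "affine hull (walsh_facet n col v) \<subseteq> {w. v \<bullet> w = - 1}"
    by (intro hull_minimal affine_hyperplane)
  then have "v \<bullet> w = - 1" using w by auto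
  then show ?thesis
    using l1_inner_le[of v "v - w"] i
    by (simp add: infnorm_walsh_point inner_diff_right inner_walsh_point)
qed

lemma l1_norm_vertex_facet:
  assumes v: "v \<in> walsh_vertices n col" and w: "w \<in> walsh_facet n col v"
  shows "l1_norm (v - w) = 2 ^ n"
proof (rule antisym)
  show "l1_norm (v - w) \<le> 2 ^ n"
  proof (rule l1_norm_diff_hull_le)
    show "v \<in> convex hull {v}" by simp
    show "w \<in> convex hull (walsh_vertices n col - {v})" using w by (simp add: walsh_facet_def)
  qed (use v in \<open>auto simp: walsh_vertices_eq l1_norm_walsh_point_diff\<close>)
  show "2 ^ n \<le> l1_norm (v - w)"
    using v w by (intro l1_norm_vertex_affine_facet_ge hull_inc)
qed

lemma walsh_facet_nonempty:
  assumes "n \<ge> 1"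
  shows "walsh_facet n col v \<noteq> {}"
proof -
  have "1 < (2::nat) ^ n" using assms by (intro one_less_power) auto
  moreover have "l1_norm (walsh_point n col 0 - walsh_point n col 1) = 2 ^ n"
    using \<open>1 < 2 ^ n\<close> by (simp add: l1_norm_walsh_point_diff)
  then have "walsh_point n col 0 \<noteq> walsh_point n col 1" by (auto simp: l1_norm_def)
  moreover have "walsh_point n col 0 \<in> walsh_vertices n col" "walsh_point n col 1 \<in> walsh_vertices n col"
    using \<open>1 < 2 ^ n\<close> by (auto simp: walsh_vertices_eq)
  ultimately have "walsh_vertices n col - {v} \<noteq> {}" by blast
  then show ?thesis by (simp add: walsh_facet_def)
qed

text \<open>The lower bound holds on the whole affine hull, and every point of the facet attains
  it.\<close>

lemma l1_setdist_vertex_affine_facet: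
  assumes "n \<ge> 1" and v: "v \<in> walsh_vertices n col"
  shows "l1_setdist {v} (affine hull (walsh_facet n col v)) = 2 ^ n"
  unfolding l1_setdist_def
proof (rule cInf_eq_minimum)
  obtain w where w: "w \<in> walsh_facet n col v" using walsh_facet_nonempty[OF assms(1)] by blast
  then show "2 ^ n \<in> (\<lambda>(x, y). l1_norm (x - y)) ` ({v} \<times> (affine hull walsh_facet n col v))"
    using l1_norm_vertex_facet[OF v w] by (intro image_eqI[of _ _ "(v, w)"]) (auto intro: hull_inc)
qed (use l1_norm_vertex_affine_facet_ge[OF v] in auto)

section \<open>Thickness and reducedness\<close>

lemma l1_thickness_walsh_simplex: "l1_thickness (walsh_simplex n col) = 2"
proof (rule antisym)
  let ?S = "walsh_simplex n col"
  note K = compact_walsh_simplex walsh_simplex_nonempty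
  show "2 \<le> l1_thickness ?S"
    by (intro l1_thickness_ge_2 K l1_unit_ball_subset_walsh_simplex)
  obtain j :: 'd where True by simp
  define e :: "real^'d" where "e = axis j 1"
  have e: "e \<noteq> 0" "e \<bullet> x = x $ j" for x by (simp_all add: e_def axis_eq_0_iff inner_axis')
  have inf_e: "1 \<le> infnorm e"
    using component_le_infnorm_cart[of e j] by (simp add: e_def)
  \<comment> \<open>The vertices have entries of absolute value 1, so the simplex lies in a
    coordinate slab of width 2.\<close>
  have "?S \<subseteq> {x. \<bar>x $ j\<bar> \<le> 1}"
    unfolding walsh_simplex_def
  proof (rule hull_minimal)
    have "{x :: real^'d. \<bar>x $ j\<bar> \<le> 1} = {x. e \<bullet> x \<le> 1} \<inter> {x. e \<bullet> x \<ge> - 1}"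
      by (auto simp: e)
    then show "convex {x :: real^'d. \<bar>x $ j\<bar> \<le> 1}"
      by (simp add: convex_Int convex_halfspace_le convex_halfspace_ge)
  qed (auto simp: walsh_vertices_eq walsh_point_abs)
  then have bound: "\<bar>x $ j\<bar> \<le> 1" if "x \<in> ?S" for x using that by auto
  have "l1_thickness ?S \<le> l1_width ?S e" by (rule l1_thickness_minimum(2)[OF K e(1)])
  also have "\<dots> \<le> 2"
  proof (rule l1_width_le[OF K e(1)])
    fix x y assume "x \<in> ?S" "y \<in> ?S"
    then show "e \<bullet> x - e \<bullet> y \<le> 2 * infnorm e"
      using bound[of x] bound[of y] inf_e by (simp add: e)
  qed
  finally show "l1_thickness ?S \<le> 2" .
qed

lemma not_l1_reduced_walsh_simplex:
  assumes "n \<ge> 2"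
  shows "\<not> l1_reduced (walsh_simplex n col)"
proof -
  \<comment> \<open>Here \<open>n \<ge> 2\<close> makes the inclusion of the ball proper: a vertex
    has norm at least 3. For \<open>n = 1\<close> the simplex is the interval from -1 to 1, which is
    the ball.\<close>
  have "2 ^ 2 \<le> (2::real) ^ n" using assms by (intro power_increasing) auto
  then have "(4::real) \<le> 2 ^ n" by simp
  then have "walsh_point n col 0 \<bullet> walsh_point n col 0 \<ge> 3"
    by (simp add: inner_walsh_point)
  then have "walsh_point n col 0 \<notin> l1_unit_ball"
    using l1_inner_le[of "walsh_point n col 0" "walsh_point n col 0"]
    by (simp add: infnorm_walsh_point l1_unit_ball_def)
  then have "l1_unit_ball \<subset> walsh_simplex n col"
    using l1_unit_ball_subset_walsh_simplex walsh_point_in_simplex[of 0] by auto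
  moreover have "2 \<le> l1_thickness (l1_unit_ball :: (real^'d) set)"
    using convex_body_l1_unit_ball by (intro l1_thickness_ge_2) (auto simp: convex_body_def)
  ultimately show ?thesis
    using convex_body_l1_unit_ball l1_thickness_walsh_simplex unfolding l1_reduced_def by force
qed

end

theorem proposition3:
  fixes n :: nat and col :: "'d::finite \<Rightarrow> nat"
  assumes "n \<ge> 2"
    and "bij_betw col UNIV {1..2 ^ n - 1}"
  shows "l1_diameter (walsh_simplex n col) = 2 ^ n \<and>
    (\<forall>v\<in>walsh_vertices n col.
       (\<forall>w\<in>walsh_facet n col v. l1_norm (v - w) = 2 ^ n) \<and>
       l1_setdist {v} (affine hull (walsh_facet n col v)) = 2 ^ n) \<and>
    l1_unit_ball \<subseteq> walsh_simplex n col \<and>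
    l1_thickness (walsh_simplex n col) = 2 \<and>
    \<not> l1_reduced (walsh_simplex n col)"
proof -
  note col = assms(2)
  have "n \<ge> 1" using assms(1) by simp
  then show ?thesis
    using l1_diameter_walsh_simplex[OF col] l1_norm_vertex_facet[OF col]
      l1_setdist_vertex_affine_facet[OF col] l1_unit_ball_subset_walsh_simplex[OF col]
      l1_thickness_walsh_simplex[OF col] not_l1_reduced_walsh_simplex[OF col assms(1)]
    by blast
qed

end
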